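(* Let $G=(V,E)$ be a digraph on $n$ vertices, and let $\pi=(V_1,\ldots,V_m)$ be a regular partition of $V$ with quotient matrix $B$. Let $m(x)=x^r-\alpha_{r-1}x^{r-1}-\cdots-\alpha_0$ be the minimal polynomial of $B$. For $k\ge 0$ let $n_k$ be the number of vertices of the $k$-iterated line digraph $L^k(G)$. Then $$n_k=\alpha_{r-1}n_{k-1}+\cdots+\alpha_0 n_{k-r},\qquad k=r,r+1,\ldots,$$ with the initial values, for $k=0,1,\ldots,r-1$, given by $$n_k=\sum_{i=1}^m|V_i|\sum_{j=1}^m (B^k)_{ij}=\boldsymbol{s}B^k\boldsymbol{j}^{\top},$$ where $\boldsymbol{s}=(|V_1|,\ldots,|V_m|)$ and $\boldsymbol{j}=(1,\ldots,1)\in\mathbb{R}^m$.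
   Context: A digraph $G=(V,E)$ consists of a finite set $V$ of vertices and a finite collection $E$ of arcs (directed edges) between vertices; loops and multiple arcs (several arcs from one vertex to another) are allowed. The line digraph $L(G)$ has one vertex for each arc of $G$ (parallel arcs giving distinct vertices), and there is an arc in $L(G)$ from the vertex representing an arc $a$ (from $u$ to $v$) to the vertex representing an arc $b$ (from $w$ to $z$) if and only if $v=w$. The iterated line digraphs are $L^0(G)=G$ and $L^k(G)=L(L^{k-1}(G))$ for $k\ge 1$. These may be empty, with $0$ vertices. A partition $\pi=(V_1,\ldots,V_m)$ of $V$ into nonempty cells is called regular (or equitable) if for all $i,j\in\{1,\ldots,m\}$ and $u\in V_i$, the number $b_{ij}(u)$ of arcs from $u$ to vertices of $V_j$ (counted with multiplicity) does not depend on the choice of $u\in V_i$, but only on $i$ and $j$. It is then written $b_{ij}$, and the $m\times m$ matrix $B=(b_{ij})$ is called the quotient matrix (of the adjacency matrix of $G$ with respect to $\pi$). Matrices are regarded as real matrices, and $B^0$ is the identity matrix. *)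

theory Defs
  imports "Graph_Theory.Digraph_Isomorphism" "Jordan_Normal_Form.Matrix"
    "HOL-Computational_Algebra.Polynomial" "HOL-Library.Disjoint_Sets"
begin

text \<open>
  Digraphs with loops and multiple arcs are the library's \<^locale>\<open>fin_digraph\<close>, in which
  arcs are objects of their own with a tail and a head.
\<close>

definition line_digraph :: "('a, 'b) pre_digraph \<Rightarrow> ('b, 'b \<times> 'b) pre_digraph" where
  "line_digraph G =
     \<lparr> verts = arcs G,
       arcs = {(a, b). a \<in> arcs G \<and> b \<in> arcs G \<and> head G a = tail G b},
       tail = fst, head = snd \<rparr>"

text \<open>
  Taking line digraphs changes the types of vertices and arcs, so the iteration takes place in
  one universal type: the vertices and arcs of \<open>G\<close> are injected by \<open>Vertex\<close> and \<open>Arc\<close>, and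
  the arc \<open>(a, b)\<close> of a line digraph is represented by \<open>Join a b\<close>. The iterates are therefore
  only isomorphic to \<open>G\<close> and to the line digraph of the previous iterate; the lemmas below
  establish these isomorphisms.
\<close>

datatype ('a, 'b) node = Vertex 'a | Arc 'b | Join "('a, 'b) node" "('a, 'b) node"

text \<open>Transport of a digraph along relabellings; \<open>g\<close> is meant to be injective.\<close>

definition relabel ::
  "('a \<Rightarrow> 'c) \<Rightarrow> ('b \<Rightarrow> 'd) \<Rightarrow> ('a, 'b) pre_digraph \<Rightarrow> ('c, 'd) pre_digraph" where
  "relabel f g G = app_iso
     \<lparr> iso_verts = f, iso_arcs = g,
       iso_head = (\<lambda>e. f (head G (inv_into UNIV g e))),
       iso_tail = (\<lambda>e. f (tail G (inv_into UNIV g e))) \<rparr> G"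

primrec iterated_line_digraph ::
  "nat \<Rightarrow> ('a, 'b) pre_digraph \<Rightarrow> (('a, 'b) node, ('a, 'b) node) pre_digraph" where
  "iterated_line_digraph 0 G = relabel Vertex Arc G"
| "iterated_line_digraph (Suc k) G =
     relabel id (case_prod Join) (line_digraph (iterated_line_digraph k G))"

lemma digraph_iso_relabel:
  assumes "wf_digraph G" "inj f" "inj g"
  shows "digraph_iso G (relabel f g G)"
proof -
  let ?h = "\<lparr> iso_verts = f, iso_arcs = g,
    iso_head = (\<lambda>e. f (head G (inv_into UNIV g e))),
    iso_tail = (\<lambda>e. f (tail G (inv_into UNIV g e))) \<rparr>"
  have "pre_digraph.digraph_isomorphism G ?h"
    using assms inj_on_subset[OF assms(2) subset_UNIV] inj_on_subset[OF assms(3) subset_UNIV]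
    by (simp add: pre_digraph.digraph_isomorphism_def)
  then show ?thesis
    unfolding digraph_iso_def relabel_def by blast
qed

lemma fin_digraph_line_digraph:
  assumes "fin_digraph G"
  shows "fin_digraph (line_digraph G)"
proof -
  interpret fin_digraph G by fact
  have "{(a, b). a \<in> arcs G \<and> b \<in> arcs G \<and> head G a = tail G b} \<subseteq> arcs G \<times> arcs G"
    by auto
  then have "finite {(a, b). a \<in> arcs G \<and> b \<in> arcs G \<and> head G a = tail G b}"
    by (rule finite_subset) simp
  then show ?thesis
    by unfold_locales (auto simp: line_digraph_def)
qed

lemma fin_digraph_relabel:
  assumes "fin_digraph G" "inj g"
  shows "fin_digraph (relabel f g G)"
proof -
  interpret fin_digraph G by fact
  show ?thesis
    using \<open>inj g\<close> by unfold_locales (auto simp: relabel_def)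
qed

lemma inj_case_prod_Join: "inj (case_prod Join)"
  by (auto simp: inj_def)

lemma fin_digraph_iterated_line_digraph:
  assumes "fin_digraph G"
  shows "fin_digraph (iterated_line_digraph k G)"
proof (induction k)
  case 0
  have "inj (Arc :: _ \<Rightarrow> ('a, 'b) node)" by (simp add: inj_def)
  then show ?case by (simp add: fin_digraph_relabel assms)
next
  case (Suc k)
  then show ?case
    by (simp add: fin_digraph_relabel fin_digraph_line_digraph inj_case_prod_Join)
qed

lemma iterated_line_digraph_0_iso:
  assumes "fin_digraph G"
  shows "digraph_iso G (iterated_line_digraph 0 G)"
proof -
  have "wf_digraph G" using assms by (rule fin_digraph.axioms)
  then show ?thesis by (simp add: digraph_iso_relabel inj_def)
qed

lemma iterated_line_digraph_Suc_iso:
  assumes "fin_digraph G"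
  shows "digraph_iso (line_digraph (iterated_line_digraph k G))
    (iterated_line_digraph (Suc k) G)"
proof -
  have "wf_digraph (line_digraph (iterated_line_digraph k G))"
    using fin_digraph_line_digraph[OF fin_digraph_iterated_line_digraph[OF assms]]
    by (rule fin_digraph.axioms)
  then show ?thesis by (simp add: digraph_iso_relabel inj_case_prod_Join)
qed

definition arc_count :: "('a, 'b) pre_digraph \<Rightarrow> 'a \<Rightarrow> 'a set \<Rightarrow> nat" where
  "arc_count G u W = card {e \<in> out_arcs G u. head G e \<in> W}"

text \<open>A partition is the list of its cells, indexed from 0.\<close>

definition regular_partition :: "('a, 'b) pre_digraph \<Rightarrow> 'a set list \<Rightarrow> bool" where
  "regular_partition G \<pi> \<longleftrightarrow>
     distinct \<pi> \<and> partition_on (verts G) (set \<pi>) \<and>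
     (\<forall>i < length \<pi>. \<forall>j < length \<pi>. \<forall>u \<in> \<pi> ! i. \<forall>v \<in> \<pi> ! i.
        arc_count G u (\<pi> ! j) = arc_count G v (\<pi> ! j))"

text \<open>For a regular partition the description below is unique, as cells are nonempty.\<close>

definition quotient_matrix :: "('a, 'b) pre_digraph \<Rightarrow> 'a set list \<Rightarrow> real mat" where
  "quotient_matrix G \<pi> = mat (length \<pi>) (length \<pi>)
     (\<lambda>(i, j). real (THE b. \<forall>u \<in> \<pi> ! i. arc_count G u (\<pi> ! j) = b))"

lemma quotient_matrix_index:
  assumes "regular_partition G \<pi>" "i < length \<pi>" "j < length \<pi>" "u \<in> \<pi> ! i"
  shows "quotient_matrix G \<pi> $$ (i, j) = real (arc_count G u (\<pi> ! j))"
proof -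
  have *: "\<forall>v \<in> \<pi> ! i. arc_count G v (\<pi> ! j) = arc_count G u (\<pi> ! j)"
    using assms unfolding regular_partition_def by blast
  have "(THE b. \<forall>v \<in> \<pi> ! i. arc_count G v (\<pi> ! j) = b) = arc_count G u (\<pi> ! j)"
  proof (rule the_equality)
    show "\<forall>v \<in> \<pi> ! i. arc_count G v (\<pi> ! j) = arc_count G u (\<pi> ! j)" by (rule *)
    show "b = arc_count G u (\<pi> ! j)" if "\<forall>v \<in> \<pi> ! i. arc_count G v (\<pi> ! j) = b" for b
      using that assms(4) by metis
  qed
  then show ?thesis
    using assms(2,3) by (simp add: quotient_matrix_def)
qed

text \<open>The matrix \<open>p(A)\<close> for a square matrix \<open>A\<close>, entry by entry.\<close>

definition poly_mat :: "real poly \<Rightarrow> real mat \<Rightarrow> real mat" where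
  "poly_mat p A = mat (dim_row A) (dim_row A)
     (\<lambda>(i, j). \<Sum>k\<le>degree p. coeff p k * (A ^\<^sub>m k) $$ (i, j))"

definition is_minimal_poly :: "real mat \<Rightarrow> real poly \<Rightarrow> bool" where
  "is_minimal_poly A p \<longleftrightarrow>
     lead_coeff p = 1 \<and> poly_mat p A = 0\<^sub>m (dim_row A) (dim_row A) \<and>
     (\<forall>q. q \<noteq> 0 \<longrightarrow> poly_mat q A = 0\<^sub>m (dim_row A) (dim_row A) \<longrightarrow> degree p \<le> degree q)"

end

theory Submission
  imports Defs
begin

text \<open>
  The vertices of the \<open>k\<close>-th iterated line digraph correspond to the walks of length \<open>k\<close> in \<open>G\<close>,
  so the theorem is about the growth of the number of walks. Instead of setting up this bijection,
  the proof compares walk counts: a walk of length \<open>l\<close> in the line digraph that starts at the arc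
  \<open>a\<close> amounts to a walk of length \<open>l\<close> in \<open>G\<close> that starts at the head of \<open>a\<close>, that is, to a walk of
  length \<open>l + 1\<close> beginning with \<open>a\<close>. One line digraph step therefore raises the length of the walks
  by one, and \<open>k\<close> steps turn walks of length 0, which are vertices, into walks of length \<open>k\<close>
  (\<open>card_verts_iterated_line_digraph\<close>).

  Regularity of the partition says that the arcs leaving a vertex of cell \<open>i\<close> distribute over the
  cells according to row \<open>i\<close> of the quotient matrix \<open>B\<close>. By induction, the number of walks of length
  \<open>k\<close> from such a vertex is the sum of row \<open>i\<close> of the \<open>k\<close>-th power of \<open>B\<close>
  (\<open>walk_count_eq_row_sum\<close>). Summing over all vertices expresses the number of walks of length \<open>k\<close>
  as a fixed linear functional of the \<open>k\<close>-th power of \<open>B\<close>. This is the formula for the initial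
  values; it holds for every \<open>k\<close>. Multiplying the polynomial relation satisfied by \<open>B\<close> by a power
  of \<open>B\<close> and applying the functional gives the recurrence (\<open>row_sum_pow_mat_recurrence\<close>).
\<close>

section \<open>Counting walks\<close>

primrec walk_count :: "('a, 'b) pre_digraph \<Rightarrow> nat \<Rightarrow> 'a \<Rightarrow> nat" where
  "walk_count G 0 u = 1"
| "walk_count G (Suc k) u = (\<Sum>e \<in> out_arcs G u. walk_count G k (head G e))"

definition total_walk_count :: "('a, 'b) pre_digraph \<Rightarrow> nat \<Rightarrow> nat" where
  "total_walk_count G k = (\<Sum>u \<in> verts G. walk_count G k u)"

section \<open>Walks in line digraphs\<close>

lemma out_arcs_line_digraph:
  assumes "a \<in> arcs G"
  shows "out_arcs (line_digraph G) a = Pair a ` out_arcs G (head G a)"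
  using assms by (auto simp: line_digraph_def out_arcs_def)

text \<open>
  A walk in the line digraph lists consecutive arcs of \<open>G\<close>. Once its first arc \<open>a\<close> is fixed, the
  arcs that follow form a walk in \<open>G\<close> from the head of \<open>a\<close>.
\<close>

lemma walk_count_line_digraph:
  assumes "a \<in> arcs G"
  shows "walk_count (line_digraph G) k a = walk_count G k (head G a)"
  using assms
proof (induction k arbitrary: a)
  case (Suc k)
  have "head (line_digraph G) = snd"
    by (simp add: line_digraph_def)
  then have "walk_count (line_digraph G) (Suc k) a =
      (\<Sum>b \<in> out_arcs G (head G a). walk_count (line_digraph G) k b)"
    by (simp add: out_arcs_line_digraph[OF Suc.prems] sum.reindex inj_on_def)
  also have "\<dots> = (\<Sum>b \<in> out_arcs G (head G a). walk_count G k (head G b))"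
    by (intro sum.cong) (auto intro: Suc.IH)
  finally show ?case by simp
qed simp

text \<open>
  Prefixing the arc \<open>a\<close> to a walk from its head yields every nonempty walk of \<open>G\<close> exactly once; the
  sum over the arcs is grouped by their tails to meet the recursion for walks of length \<open>k + 1\<close>.
\<close>

lemma total_walk_count_line_digraph:
  assumes "fin_digraph G"
  shows "total_walk_count (line_digraph G) k = total_walk_count G (Suc k)"
proof -
  interpret fin_digraph G by fact
  have "total_walk_count (line_digraph G) k = (\<Sum>a \<in> arcs G. walk_count G k (head G a))"
    unfolding total_walk_count_def
    by (intro sum.cong) (simp add: line_digraph_def, rule walk_count_line_digraph)
  also have "\<dots> = (\<Sum>u \<in> verts G. \<Sum>a | a \<in> arcs G \<and> tail G a = u. walk_count G k (head G a))"
    by (intro sum.group[symmetric]) auto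
  finally show ?thesis
    by (simp add: total_walk_count_def out_arcs_def)
qed

lemma walk_count_relabel:
  assumes "wf_digraph G" "inj f" "inj g" "u \<in> verts G"
  shows "walk_count (relabel f g G) k (f u) = walk_count G k u"
  using assms(4)
proof (induction k arbitrary: u)
  case (Suc k)
  have head: "head (relabel f g G) (g e) = f (head G e)" for e
    by (simp add: relabel_def assms)
  have "out_arcs (relabel f g G) (f u) = g ` out_arcs G u"
    using assms(2,3) by (auto simp: relabel_def out_arcs_def inj_eq)
  then have "walk_count (relabel f g G) (Suc k) (f u) =
      (\<Sum>e \<in> out_arcs G u. walk_count (relabel f g G) k (f (head G e)))"
    by (simp add: sum.reindex[OF inj_on_subset[OF assms(3)]] head)
  also have "\<dots> = (\<Sum>e \<in> out_arcs G u. walk_count G k (head G e))"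
    by (intro sum.cong) (auto intro!: Suc.IH wf_digraph.head_in_verts[OF assms(1)])
  finally show ?case by simp
qed simp

lemma total_walk_count_relabel:
  assumes "wf_digraph G" "inj f" "inj g"
  shows "total_walk_count (relabel f g G) k = total_walk_count G k"
proof -
  have "verts (relabel f g G) = f ` verts G"
    by (simp add: relabel_def)
  then show ?thesis
    by (simp add: total_walk_count_def sum.reindex[OF inj_on_subset[OF assms(2)]]
        walk_count_relabel[OF assms])
qed

text \<open>
  The iteration applies the line digraph operator last, so only the outermost step can be unfolded,
  and unfolding it lengthens the walks to be counted in the previous iterate. This is why the
  statement concerns walks of arbitrary length \<open>l\<close>, although only \<open>l = 0\<close> is of interest.
\<close>

lemma total_walk_count_iterated_line_digraph:
  assumes "fin_digraph G"
  shows "total_walk_count (iterated_line_digraph k G) l = total_walk_count G (k + l)"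
proof (induction k arbitrary: l)
  case 0
  show ?case
    using fin_digraph.axioms(1)[OF assms] by (simp add: total_walk_count_relabel inj_def)
next
  case (Suc k)
  have fin: "fin_digraph (iterated_line_digraph k G)"
    by (rule fin_digraph_iterated_line_digraph[OF assms])
  have "total_walk_count (iterated_line_digraph (Suc k) G) l =
      total_walk_count (line_digraph (iterated_line_digraph k G)) l"
    using fin_digraph.axioms(1)[OF fin_digraph_line_digraph[OF fin]]
    by (simp add: total_walk_count_relabel inj_case_prod_Join)
  then show ?case
    by (simp add: total_walk_count_line_digraph[OF fin] Suc.IH)
qed

corollary card_verts_iterated_line_digraph:
  assumes "fin_digraph G"
  shows "card (verts (iterated_line_digraph k G)) = total_walk_count G k"
  using total_walk_count_iterated_line_digraph[OF assms, of k 0]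
  by (simp add: total_walk_count_def)

section \<open>Walks and the quotient matrix\<close>

lemma regular_partition_nth_disjoint:
  assumes "regular_partition G \<pi>" "i < length \<pi>" "j < length \<pi>" "i \<noteq> j"
  shows "\<pi> ! i \<inter> \<pi> ! j = {}"
  using assms unfolding regular_partition_def partition_on_def
  by (metis disjointD nth_eq_iff_index_eq nth_mem)

lemma sum_regular_partition:
  assumes "regular_partition G \<pi>" "finite (verts G)"
  shows "(\<Sum>u \<in> verts G. f u) = (\<Sum>i < length \<pi>. \<Sum>u \<in> \<pi> ! i. f u)"
proof -
  have cover: "verts G = (\<Union>i < length \<pi>. \<pi> ! i)"
    using assms(1) by (auto simp: regular_partition_def partition_on_def set_conv_nth)
  have "(\<Sum>u \<in> (\<Union>i < length \<pi>. \<pi> ! i). f u) = (\<Sum>i < length \<pi>. \<Sum>u \<in> \<pi> ! i. f u)"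
  proof (rule sum.UNION_disjoint)
    show "\<forall>i \<in> {..<length \<pi>}. finite (\<pi> ! i)"
      using assms(2) unfolding cover by simp
    show "\<forall>i \<in> {..<length \<pi>}. \<forall>j \<in> {..<length \<pi>}. i \<noteq> j \<longrightarrow> \<pi> ! i \<inter> \<pi> ! j = {}"
      using regular_partition_nth_disjoint[OF assms(1)] by simp
  qed simp
  then show ?thesis using cover by simp
qed

lemma pow_mat_add:
  fixes A :: "'a::semiring_1 mat"
  assumes "A \<in> carrier_mat n n"
  shows "A ^\<^sub>m (k + l) = A ^\<^sub>m k * A ^\<^sub>m l"
proof (induction l)
  case (Suc l)
  then show ?case
    using assms by (simp add: assoc_mult_mat[of _ n n _ n _ n])
qed (use assms in simp)

definition row_sum :: "'a::comm_monoid_add mat \<Rightarrow> nat \<Rightarrow> 'a" where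
  "row_sum A i = (\<Sum>j < dim_col A. A $$ (i, j))"

lemma row_sum_mult:
  fixes A C :: "'a::semiring_0 mat"
  assumes "A \<in> carrier_mat l m" "C \<in> carrier_mat m n" "i < l"
  shows "row_sum (A * C) i = (\<Sum>c < m. A $$ (i, c) * row_sum C c)"
proof -
  have "row_sum (A * C) i = (\<Sum>j < n. \<Sum>c < m. A $$ (i, c) * C $$ (c, j))"
    using assms by (simp add: row_sum_def scalar_prod_def atLeast0LessThan)
  also have "\<dots> = (\<Sum>c < m. \<Sum>j < n. A $$ (i, c) * C $$ (c, j))"
    by (rule sum.swap)
  finally show ?thesis
    using assms(2) by (simp add: row_sum_def sum_distrib_left)
qed

lemma quotient_matrix_carrier [simp]:
  "quotient_matrix G \<pi> \<in> carrier_mat (length \<pi>) (length \<pi>)"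
  by (simp add: quotient_matrix_def)

text \<open>
  A walk of length \<open>k + 1\<close> from \<open>u\<close> is a first arc followed by a walk of length \<open>k\<close>. By induction the
  number of continuations depends only on the cell that contains the head of the first arc, and
  regularity fixes the number of arcs into each cell.
\<close>

lemma walk_count_eq_row_sum:
  assumes "fin_digraph G" "regular_partition G \<pi>" "i < length \<pi>" "u \<in> \<pi> ! i"
  shows "real (walk_count G k u) = row_sum (quotient_matrix G \<pi> ^\<^sub>m k) i"
  using assms(3,4)
proof (induction k arbitrary: i u)
  case 0
  let ?m = "length \<pi>"
  have "row_sum (quotient_matrix G \<pi> ^\<^sub>m 0) i = (\<Sum>j < ?m. if i = j then 1 else 0)"
    using 0 unfolding row_sum_def by (intro sum.cong) (auto simp: quotient_matrix_def)
  then show ?case using 0 by simp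
next
  case (Suc k)
  interpret fin_digraph G by fact
  let ?B = "quotient_matrix G \<pi>" and ?m = "length \<pi>"
  let ?out = "\<lambda>c. {e \<in> out_arcs G u. head G e \<in> \<pi> ! c}"
  \<comment> \<open>The cells cover the vertices, so the arcs leaving \<open>u\<close> can be grouped by the cell of their head.\<close>
  have cover: "out_arcs G u = (\<Union>c < ?m. ?out c)"
  proof -
    have "\<exists>c < ?m. head G e \<in> \<pi> ! c" if "e \<in> out_arcs G u" for e
    proof -
      have "head G e \<in> \<Union> (set \<pi>)"
        using that assms(2) by (simp add: regular_partition_def partition_on_def)
      then show ?thesis by (auto simp: in_set_conv_nth)
    qed
    then show ?thesis by fastforce
  qed
  have "real (walk_count G (Suc k) u) =
      (\<Sum>e \<in> (\<Union>c < ?m. ?out c). real (walk_count G k (head G e)))"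
    unfolding cover[symmetric] by simp
  also have "\<dots> = (\<Sum>c < ?m. \<Sum>e \<in> ?out c. real (walk_count G k (head G e)))"
  proof (rule sum.UNION_disjoint)
    show "\<forall>c \<in> {..<?m}. \<forall>d \<in> {..<?m}. c \<noteq> d \<longrightarrow> ?out c \<inter> ?out d = {}"
      using regular_partition_nth_disjoint[OF assms(2)] by fastforce
  qed simp_all
  also have "\<dots> = (\<Sum>c < ?m. \<Sum>e \<in> ?out c. row_sum (?B ^\<^sub>m k) c)"
    by (intro sum.cong) (auto intro!: Suc.IH)
  also have "\<dots> = (\<Sum>c < ?m. ?B $$ (i, c) * row_sum (?B ^\<^sub>m k) c)"
    using Suc.prems by (intro sum.cong)
      (simp_all add: quotient_matrix_index[OF assms(2), of i _ u] arc_count_def)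
  \<comment> \<open>Powers are defined by multiplication on the right, whereas the first arc contributes a
    factor \<open>B\<close> on the left; \<open>pow_mat_add\<close> moves it.\<close>
  also have "\<dots> = row_sum (?B ^\<^sub>m 1 * ?B ^\<^sub>m k) i"
    using Suc.prems by (simp add: row_sum_mult[of _ ?m ?m _ ?m] quotient_matrix_def)
  also have "?B ^\<^sub>m 1 * ?B ^\<^sub>m k = ?B ^\<^sub>m Suc k"
    using pow_mat_add[of ?B ?m 1 k] by simp
  finally show ?case .
qed

lemma total_walk_count_eq_row_sums:
  assumes "fin_digraph G" "regular_partition G \<pi>"
  shows "real (total_walk_count G k) =
    (\<Sum>i < length \<pi>. real (card (\<pi> ! i)) * row_sum (quotient_matrix G \<pi> ^\<^sub>m k) i)"
proof -
  interpret fin_digraph G by fact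
  have "real (total_walk_count G k) =
      (\<Sum>i < length \<pi>. \<Sum>u \<in> \<pi> ! i. real (walk_count G k u))"
    using sum_regular_partition[OF assms(2), of "\<lambda>u. real (walk_count G k u)"]
    by (simp add: total_walk_count_def)
  also have "\<dots> = (\<Sum>i < length \<pi>. \<Sum>u \<in> \<pi> ! i. row_sum (quotient_matrix G \<pi> ^\<^sub>m k) i)"
    by (intro sum.cong) (auto intro!: walk_count_eq_row_sum[OF assms])
  finally show ?thesis by simp
qed

section \<open>The recurrence\<close>

text \<open>
  A polynomial of this shape is monic of degree \<open>r\<close>, so the relation that it imposes on \<open>A\<close> can be solved
  for the \<open>r\<close>-th power.
\<close>

lemma pow_mat_index_if_poly_mat_eq_0:
  assumes "A \<in> carrier_mat m m"
    and "poly_mat (monom 1 r - (\<Sum>i<r. monom (\<alpha> i) i)) A = 0\<^sub>m m m"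
    and "a < m" "b < m"
  shows "(A ^\<^sub>m r) $$ (a, b) = (\<Sum>i<r. \<alpha> i * (A ^\<^sub>m i) $$ (a, b))"
proof -
  let ?p = "monom 1 r - (\<Sum>i<r. monom (\<alpha> i) i)"
  have coeff: "coeff ?p k = (if k = r then 1 else 0) - (if k < r then \<alpha> k else 0)" for k
    by (simp add: coeff_sum)
  have "degree ?p = r"
  proof (rule antisym)
    show "degree ?p \<le> r" by (rule degree_le) (simp add: coeff del: coeff_diff)
    show "r \<le> degree ?p" by (rule le_degree) (simp add: coeff del: coeff_diff)
  qed
  then have "0 = (\<Sum>k\<le>r. coeff ?p k * (A ^\<^sub>m k) $$ (a, b))"
    using arg_cong[OF assms(2), of "\<lambda>M. M $$ (a, b)"] assms(1,3,4) by (simp add: poly_mat_def)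
  also have "\<dots> = (A ^\<^sub>m r) $$ (a, b) + (\<Sum>k<r. - \<alpha> k * (A ^\<^sub>m k) $$ (a, b))"
    by (simp add: coeff del: coeff_diff flip: lessThan_Suc_atMost)
  finally show ?thesis by (simp add: sum_negf)
qed

text \<open>
  The row sums of a product \<open>M * N\<close> depend linearly on \<open>M\<close>. With \<open>N\<close> the \<open>t\<close>-th power of \<open>A\<close>, the
  relation between the powers of \<open>A\<close> up to \<open>r\<close> thus carries over to the row sums, shifted by \<open>t\<close>.
\<close>

lemma row_sum_pow_mat_recurrence:
  assumes "A \<in> carrier_mat m m"
    and "poly_mat (monom 1 r - (\<Sum>i<r. monom (\<alpha> i) i)) A = 0\<^sub>m m m"
    and "a < m"
  shows "row_sum (A ^\<^sub>m (r + t)) a = (\<Sum>i<r. \<alpha> i * row_sum (A ^\<^sub>m (i + t)) a)"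
proof -
  have split: "row_sum (A ^\<^sub>m (i + t)) a = (\<Sum>c < m. (A ^\<^sub>m i) $$ (a, c) * row_sum (A ^\<^sub>m t) c)" for i
    using assms by (simp add: pow_mat_add[OF assms(1)] row_sum_mult[of _ m m _ m])
  have "row_sum (A ^\<^sub>m (r + t)) a =
      (\<Sum>c < m. \<Sum>i<r. \<alpha> i * ((A ^\<^sub>m i) $$ (a, c) * row_sum (A ^\<^sub>m t) c))"
    using pow_mat_index_if_poly_mat_eq_0[OF assms]
    by (simp add: split sum_distrib_right mult.assoc)
  also have "\<dots> = (\<Sum>i<r. \<Sum>c < m. \<alpha> i * ((A ^\<^sub>m i) $$ (a, c) * row_sum (A ^\<^sub>m t) c))"
    by (rule sum.swap)
  finally show ?thesis
    by (simp add: split sum_distrib_left)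
qed

theorem theorem3p1:
  fixes G :: "('a, 'b) pre_digraph" and \<pi> :: "'a set list" and m r :: nat
    and B :: "real mat" and \<alpha> :: "nat \<Rightarrow> real" and n :: "nat \<Rightarrow> nat" and s j :: "real vec"
  assumes "fin_digraph G"
    and "regular_partition G \<pi>"
    and "m = length \<pi>"
    and "B = quotient_matrix G \<pi>"
    and "is_minimal_poly B (monom 1 r - (\<Sum>i<r. monom (\<alpha> i) i))"
    and "\<And>k. n k = card (verts (iterated_line_digraph k G))"
    and "s = vec m (\<lambda>i. real (card (\<pi> ! i)))"
    and "j = vec m (\<lambda>i. 1)"
  shows "(\<forall>k\<ge>r. real (n k) = (\<Sum>i=1..r. \<alpha> (r - i) * real (n (k - i)))) \<and>
    (\<forall>k<r. real (n k) = (\<Sum>a<m. real (card (\<pi> ! a)) * (\<Sum>b<m. (B ^\<^sub>m k) $$ (a, b))) \<and>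
           real (n k) = s \<bullet> ((B ^\<^sub>m k) *\<^sub>v j))"
proof (intro conjI allI impI)
  have B: "B \<in> carrier_mat m m"
    by (simp add: assms(3,4))
  have n: "real (n k) = (\<Sum>a<m. real (card (\<pi> ! a)) * row_sum (B ^\<^sub>m k) a)" for k
    by (simp add: assms(3,4,6) card_verts_iterated_line_digraph[OF assms(1)]
        total_walk_count_eq_row_sums[OF assms(1,2)])
  have row_sum: "row_sum (B ^\<^sub>m k) a = (\<Sum>b<m. (B ^\<^sub>m k) $$ (a, b))" for k a
    unfolding row_sum_def using pow_carrier_mat[OF B, of k] by (metis carrier_matD(2))
  show sums: "real (n k) = (\<Sum>a<m. real (card (\<pi> ! a)) * (\<Sum>b<m. (B ^\<^sub>m k) $$ (a, b)))" for k
    by (simp add: n row_sum)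
  have "((B ^\<^sub>m k) *\<^sub>v j) $ a = (\<Sum>b<m. (B ^\<^sub>m k) $$ (a, b))" if "a < m" for k a
    using pow_carrier_mat[OF B, of k] that unfolding assms(8)
    by (auto simp: scalar_prod_def atLeast0LessThan simp del: pow_mat_dim pow_mat_dim_square
        intro!: sum.cong)
  moreover have "dim_vec ((B ^\<^sub>m k) *\<^sub>v j) = m" for k
    using pow_carrier_mat[OF B, of k] by (metis carrier_matD(1) dim_mult_mat_vec)
  ultimately show "real (n k) = s \<bullet> ((B ^\<^sub>m k) *\<^sub>v j)" for k
    by (simp add: sums assms(7) scalar_prod_def atLeast0LessThan)
  show "real (n k) = (\<Sum>i=1..r. \<alpha> (r - i) * real (n (k - i)))" if "k \<ge> r" for k
  proof -
    obtain t where k: "k = r + t"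
      using le_Suc_ex[OF \<open>r \<le> k\<close>] by blast
    have zero: "poly_mat (monom 1 r - (\<Sum>i<r. monom (\<alpha> i) i)) B = 0\<^sub>m m m"
      using assms(5) unfolding is_minimal_poly_def carrier_matD(1)[OF B] by blast
    have "real (n k) = (\<Sum>a<m. \<Sum>i<r. \<alpha> i * (real (card (\<pi> ! a)) * row_sum (B ^\<^sub>m (i + t)) a))"
      unfolding n k
      by (intro sum.cong refl)
        (simp add: row_sum_pow_mat_recurrence[OF B zero] sum_distrib_left mult.left_commute)
    also have "\<dots> = (\<Sum>i<r. \<alpha> i * real (n (i + t)))"
      unfolding n sum_distrib_left by (rule sum.swap)
    also have "\<dots> = (\<Sum>i=1..r. \<alpha> (r - i) * real (n (k - i)))"
      by (rule sum.reindex_bij_witness[of _ "\<lambda>i. r - i" "\<lambda>i. r - i"]) (auto simp: k add.commute)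
    finally show ?thesis .
  qed
qed

end
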